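(* Let $P\in\mathcal{P}$ be an arbitrary token distribution on $V$. Then $$\mathbb{D}(P,F_{GR})=\mathbb{D}(P,F_{IS})=1-\sum_{t\in V}P(t)^2,$$ and $$0.5\Big(1-\max_{t\in V}P(t)\Big)\le \mathbb{D}(P,F_{PR})\le 0.5-\max\Big\{\max_{t\in V}P(t)-0.5,\,0\Big\}.$$ Moreover, $\mathbb{D}(P,F_{PR})\le\mathbb{D}(P,F_{IS})=\mathbb{D}(P,F_{GR})$.
   Context: $V=\{t_1,\dots,t_N\}$ is a finite token set and $\mathcal{P}$ is the set of probability distributions on $V$. A PDA-rule is a map $F:\mathcal{P}\times K\to\mathcal{P}$, where $K$ is the space of watermark keys, carrying a probability distribution; $\mathbb{E}_k$ is expectation over a random key $k$. The expected total variation is $$\mathbb{D}(P,F):=1-\mathbb{E}_k\Big[\sum_{t\in V}\min\{P(t),F(P,k)(t)\}\Big].$$ $\delta_t$ denotes the point mass at $t\in V$. The three PDA-rules are: - Gumbel-reparametrization: $F_{GR}(P,k)=\delta_{t_{m^*}}$ with $m^*=\arg\max_{m\in\{1,\dots,N\}}(g_m(k)+\log P(t_m))$, where, over the random key, $g_1(k),\dots,g_N(k)$ are i.i.d. standard $\mathrm{Gumbel}(0,1)$ variables (and $\log 0=-\infty$). - Inverse-sampling: $F_{IS}(P,k)=\delta_{t_{m^*}}$ where $m^*$ is the index with $r(k)\in\big[\sum_{j=1}^{m^*-1}P(t_j),\sum_{j=1}^{m^*}P(t_j)\big]$, and $r(k)$ is uniform on $[0,1]$ over the random key (ties occur with probability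 zero). - Permute-reweight: over the random key, $\pi(\cdot\mid k):V\to\{1,\dots,N\}$ is a uniformly random bijection, and $$F_{PR}(P,k)(t)=\max\Big\{2\!\!\sum_{t':\pi(t'|k)\le\pi(t|k)}\!\!P(t')-1,0\Big\}-\max\Big\{2\!\!\sum_{t':\pi(t'|k)\le\pi(t|k)-1}\!\!P(t')-1,0\Big\}.$$ *)

theory Defs
  imports "HOL-Probability.Probability"
begin

text \<open>
  The token set \<open>V\<close> is the universe of a finite type \<open>'v\<close>, so a token distribution is a
  \<open>'v pmf\<close>.  Where a rule refers to the order of the tokens \<open>t\<^sub>1, \<dots>, t\<^sub>N\<close>, this order is given by a
  bijection \<open>tok\<close> from \<open>{1..N}\<close> onto the universe.
  The space of watermark keys is a probability space \<open>M\<close> over \<open>'k\<close>.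
\<close>

type_synonym ('v, 'k) pda_rule = "'v pmf \<Rightarrow> 'k \<Rightarrow> 'v pmf"

definition expected_tv :: "'k measure \<Rightarrow> 'v::finite pmf \<Rightarrow> ('v, 'k) pda_rule \<Rightarrow> real" where
  "expected_tv M P F = 1 - (LINT k|M. (\<Sum>t\<in>UNIV. min (pmf P t) (pmf (F P k) t)))"

definition log_prob :: "real \<Rightarrow> ereal" where
  "log_prob p = (if p = 0 then -\<infinity> else ereal (ln p))"

text \<open>Ties in the following two rules are broken by Hilbert choice from the set of admissible
  indices; they occur with probability zero.\<close>

definition gumbel_rule ::
    "nat \<Rightarrow> (nat \<Rightarrow> 'v) \<Rightarrow> (nat \<Rightarrow> 'k \<Rightarrow> real) \<Rightarrow> ('v, 'k) pda_rule" where
  "gumbel_rule N tok g P k =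
     return_pmf (tok (arg_max (\<lambda>m. ereal (g m k) + log_prob (pmf P (tok m))) (\<lambda>m. m \<in> {1..N})))"

definition inverse_sampling_rule ::
    "nat \<Rightarrow> (nat \<Rightarrow> 'v) \<Rightarrow> ('k \<Rightarrow> real) \<Rightarrow> ('v, 'k) pda_rule" where
  "inverse_sampling_rule N tok r P k =
     return_pmf (tok (SOME m. m \<in> {1..N} \<and>
       r k \<in> {(\<Sum>j = 1..m - 1. pmf P (tok j)) .. (\<Sum>j = 1..m. pmf P (tok j))}))"

definition permute_reweight_fun ::
    "('k \<Rightarrow> 'v \<Rightarrow> nat) \<Rightarrow> 'v::finite pmf \<Rightarrow> 'k \<Rightarrow> 'v \<Rightarrow> real" where
  "permute_reweight_fun \<pi> P k t =
     max (2 * (\<Sum>t' | \<pi> k t' \<le> \<pi> k t. pmf P t') - 1) 0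
     - max (2 * (\<Sum>t' | \<pi> k t' \<le> \<pi> k t - 1. pmf P t') - 1) 0"

definition permute_reweight_rule :: "('k \<Rightarrow> 'v \<Rightarrow> nat) \<Rightarrow> ('v::finite, 'k) pda_rule" where
  "permute_reweight_rule \<pi> P k = embed_pmf (permute_reweight_fun \<pi> P k)"

text \<open>\<open>embed_pmf\<close> is only specified on genuine probability mass functions, which the
  permute-reweight formula defines whenever \<open>\<pi> k\<close> is a bijection.\<close>

lemma permute_reweight_fun_nonneg: "0 \<le> permute_reweight_fun \<pi> P k t"
proof -
  have "(\<Sum>t' | \<pi> k t' \<le> \<pi> k t - 1. pmf P t') \<le> (\<Sum>t' | \<pi> k t' \<le> \<pi> k t. pmf P t')"
    by (rule sum_mono2) auto
  then show ?thesis unfolding permute_reweight_fun_def by linarith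
qed

lemma sum_permute_reweight_fun:
  fixes P :: "'v::finite pmf"
  assumes "bij_betw (\<pi> k) UNIV {1..N}"
  shows "(\<Sum>t\<in>UNIV. permute_reweight_fun \<pi> P k t) = 1"
proof -
  define G where "G m = max (2 * (\<Sum>t' | \<pi> k t' \<le> m. pmf P t') - 1) 0" for m
  have im: "\<pi> k t \<in> {1..N}" for t using assms by (auto simp: bij_betw_def)
  have "(\<Sum>t\<in>UNIV. permute_reweight_fun \<pi> P k t) = (\<Sum>t\<in>UNIV. G (\<pi> k t) - G (\<pi> k t - 1))"
    by (simp add: permute_reweight_fun_def G_def)
  also have "\<dots> = (\<Sum>m\<in>{1..N}. G m - G (m - 1))"
    by (rule sum.reindex_bij_betw[OF assms])
  also have "\<dots> = G N - G 0"
    by (induction N) auto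
  also have "\<dots> = 1"
  proof -
    have e: "{t'. \<pi> k t' \<le> 0} = {}" 
    proof -
      have "1 \<le> \<pi> k t'" for t' using im[of t'] by simp
      then show ?thesis by (auto simp: Suc_le_eq)
    qed
    have f: "{t'. \<pi> k t' \<le> N} = UNIV" using im by auto
    show ?thesis unfolding G_def e f by (simp add: sum_pmf_eq_1)
  qed
  finally show ?thesis .
qed

lemma pmf_permute_reweight_rule:
  fixes P :: "'v::finite pmf"
  assumes "bij_betw (\<pi> k) UNIV {1..N}"
  shows "pmf (permute_reweight_rule \<pi> P k) t = permute_reweight_fun \<pi> P k t"
  unfolding permute_reweight_rule_def
proof (rule pmf_embed_pmf)
  show "0 \<le> permute_reweight_fun \<pi> P k t" for t by (rule permute_reweight_fun_nonneg)
  show "(\<integral>\<^sup>+ t. ennreal (permute_reweight_fun \<pi> P k t) \<partial>count_space UNIV) = 1"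
    using sum_permute_reweight_fun[of \<pi> k N P, OF assms]
    by (simp add: nn_integral_count_space_finite permute_reweight_fun_nonneg)
qed

definition gumbel_density :: "real \<Rightarrow> real" where
  "gumbel_density x = exp (- (x + exp (- x)))"

definition iid_gumbel :: "'k measure \<Rightarrow> nat \<Rightarrow> (nat \<Rightarrow> 'k \<Rightarrow> real) \<Rightarrow> bool" where
  "iid_gumbel M N g \<longleftrightarrow>
     prob_space.indep_vars M (\<lambda>_. borel) g {1..N} \<and>
     (\<forall>m\<in>{1..N}. distributed M lborel (g m) (\<lambda>x. ennreal (gumbel_density x)))"

definition uniform_unit :: "'k measure \<Rightarrow> ('k \<Rightarrow> real) \<Rightarrow> bool" where
  "uniform_unit M r \<longleftrightarrow>
     r \<in> borel_measurable M \<and> distr M borel r = uniform_measure lborel {0..1}"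

definition uniform_bijection :: "'k measure \<Rightarrow> nat \<Rightarrow> ('k \<Rightarrow> 'v::finite \<Rightarrow> nat) \<Rightarrow> bool" where
  "uniform_bijection M N \<pi> \<longleftrightarrow>
     (let B = {f. bij_betw f UNIV {1..N}} in
       \<pi> \<in> measurable M (count_space B) \<and>
       distr M (count_space B) \<pi> = uniform_count_measure B)"

end

theory Submission
  imports Defs
begin

text \<open>
  Gumbel-reparametrization and inverse sampling return a point mass at a random token \<open>Z\<close>.  A lower
  bound \<open>P t \<le> Pr (Z = t)\<close> for every token \<open>t\<close> suffices, since both sides sum to one; it may be
  proved on the event that there is no tie.  Then \<open>D(P, F) = 1 - E (P Z) = 1 - (\<Sum>t. (P t)\<^sup>2)\<close>.

  For permute-reweight, average each bijection with its reversal.  If \<open>S t\<close> is the mass preceding \<open>t\<close>,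
  the two overlaps with \<open>P\<close> add up to \<open>1 + (\<Sum>t. d t)\<close>, where \<open>d t\<close> is the distance from \<open>1/2\<close> to the
  complement of the interval from \<open>S t\<close> to \<open>S t + P t\<close>, doubled.  These intervals have disjoint
  interiors, so at most one \<open>d t\<close> is nonzero, and \<open>2 * P t - 1 \<le> d t \<le> P t\<close> for all \<open>t\<close>.  The final
  comparison holds because \<open>(\<Sum>t. (P t)\<^sup>2)\<close> is at most the maximum of \<open>P\<close>.
\<close>

subsection \<open>Rules returning a point mass\<close>

lemma (in prob_space) expected_tv_point_mass:
  fixes P :: "'v::finite pmf" and Z :: "'a \<Rightarrow> 'v"
  assumes F: "\<And>k. F P k = return_pmf (Z k)"
    and Z[measurable]: "Z \<in> measurable M (count_space UNIV)"
    and lower: "\<And>v. pmf P v \<le> prob {k \<in> space M. Z k = v}"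
  shows "expected_tv M P F = 1 - (\<Sum>t\<in>UNIV. (pmf P t)\<^sup>2)"
proof -
  have total: "(\<Sum>v\<in>UNIV. prob {k \<in> space M. Z k = v}) = 1"
  proof -
    have "(\<Sum>v\<in>UNIV. prob {k \<in> space M. Z k = v}) = prob (\<Union>v. {k \<in> space M. Z k = v})"
      by (rule finite_measure_finite_Union[symmetric]) (auto simp: disjoint_family_on_def)
    also have "(\<Union>v. {k \<in> space M. Z k = v}) = space M" by auto
    finally show ?thesis by (simp add: prob_space)
  qed
  have eq: "prob {k \<in> space M. Z k = v} = pmf P v" for v
  proof -
    have "(\<Sum>v\<in>UNIV. prob {k \<in> space M. Z k = v} - pmf P v) = 0"
      by (simp add: sum_subtractf total sum_pmf_eq_1)
    then have "prob {k \<in> space M. Z k = v} - pmf P v = 0"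
      by (subst (asm) sum_nonneg_eq_0_iff) (auto simp: lower)
    then show ?thesis by simp
  qed
  \<comment> \<open>The point mass at \<open>Z k\<close> meets \<open>P\<close> only in the token
    \<open>t = Z k\<close>, and there the minimum is \<open>pmf P t\<close> because that is at most
    1.\<close>
  have "(LINT k|M. (\<Sum>t\<in>UNIV. min (pmf P t) (pmf (F P k) t)))
      = (LINT k|M. (\<Sum>t\<in>UNIV. pmf P t * indicator {k \<in> space M. Z k = t} k))"
  proof (rule Bochner_Integration.integral_cong[OF refl])
    fix k assume "k \<in> space M"
    then show "(\<Sum>t\<in>UNIV. min (pmf P t) (pmf (F P k) t))
        = (\<Sum>t\<in>UNIV. pmf P t * indicator {k \<in> space M. Z k = t} k)"
      by (intro sum.cong) (auto simp: F indicator_def pmf_le_1)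
  qed
  also have "\<dots> = (\<Sum>t\<in>UNIV. pmf P t * prob {k \<in> space M. Z k = t})"
    by (subst Bochner_Integration.integral_sum) (auto simp: integrable_indicator_iff emeasure_eq_measure)
  also have "\<dots> = (\<Sum>t\<in>UNIV. (pmf P t)\<^sup>2)"
    by (simp add: eq power2_eq_square)
  finally show ?thesis by (simp add: expected_tv_def)
qed

text \<open>The choice depends on \<open>k\<close> only through the set of admissible indices. This
  set ranges over the finite \<open>Pow I\<close>, and every function on a discrete space is
  measurable. So neither the way ties are broken nor the case of no admissible index
  matters.\<close>

lemma measurable_some_finite:
  assumes "finite I" and Q: "\<And>m. m \<in> I \<Longrightarrow> {k \<in> space M. Q k m} \<in> sets M"
  shows "(\<lambda>k. SOME m. m \<in> I \<and> Q k m) \<in> measurable M (count_space UNIV)"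
proof -
  have "(\<lambda>k. {m \<in> I. Q k m}) \<in> measurable M (count_space (Pow I))"
  proof (subst measurable_count_space_eq2)
    show "finite (Pow I)" using assms by simp
    have "(\<lambda>k. {m \<in> I. Q k m}) -` {A} \<inter> space M \<in> sets M" if "A \<subseteq> I" for A
    proof -
      have "(\<lambda>k. {m \<in> I. Q k m}) -` {A} \<inter> space M
          = {k \<in> space M. \<forall>m\<in>I. (m \<in> A) = Q k m}"
        using that by auto
      also have "\<dots> \<in> sets M"
      proof (rule sets.sets_Collect_finite_All[OF _ \<open>finite I\<close>])
        fix m assume "m \<in> I"
        then show "{k \<in> space M. (m \<in> A) = Q k m} \<in> sets M"
          using Q[of m] by (cases "m \<in> A") (auto intro!: sets.sets_Collect_neg)
      qed
      finally show ?thesis .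
    qed
    then show "(\<lambda>k. {m \<in> I. Q k m}) \<in> space M \<rightarrow> Pow I \<and>
      (\<forall>A\<in>Pow I. (\<lambda>k. {m \<in> I. Q k m}) -` {A} \<inter> space M \<in> sets M)" by auto
  qed
  then have "(\<lambda>k. SOME m. m \<in> {m \<in> I. Q k m}) \<in> measurable M (count_space UNIV)"
    by (rule measurable_compose) simp
  then show ?thesis by simp
qed

subsection \<open>The Gumbel-max identity\<close>

lemma gumbel_density_measurable[measurable]: "gumbel_density \<in> borel_measurable borel"
  unfolding gumbel_density_def by measurable

lemma gumbel_density_nonneg: "0 \<le> gumbel_density x"
  by (simp add: gumbel_density_def)

lemma (in prob_space) gumbel_cdf:
  assumes X: "distributed M lborel X (\<lambda>x. ennreal (gumbel_density x))"
  shows "prob {k \<in> space M. X k < y} = exp (- exp (- y))"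
proof -
  have [measurable]: "X \<in> borel_measurable M"
    using distributed_measurable[OF X] by simp
  \<comment> \<open>The upper tail is integrated with an antiderivative that tends to 1 at infinity;
    its complement is the strict event of the claim.\<close>
  have "emeasure M (X -` {y..} \<inter> space M) = (\<integral>\<^sup>+x. ennreal (gumbel_density x) * indicator {y..} x \<partial>lborel)"
    by (rule distributed_emeasure[OF X]) simp
  also have "\<dots> = ennreal (1 - exp (- exp (- y)))"
  proof (rule nn_integral_FTC_atLeast)
    show "((\<lambda>x. exp (- exp (- x))) has_real_derivative gumbel_density x) (at x)" for x
      by (auto intro!: derivative_eq_intros simp: gumbel_density_def exp_add[symmetric])
    have "((\<lambda>x::real. exp (- exp (- x))) \<longlongrightarrow> exp (- 0)) at_top"
      by (intro tendsto_intros filterlim_compose[OF exp_at_bot] filterlim_uminus_at_bot_at_top)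
    then show "((\<lambda>x::real. exp (- exp (- x))) \<longlongrightarrow> 1) at_top" by simp
  qed (auto simp: gumbel_density_nonneg)
  finally have "prob (X -` {y..} \<inter> space M) = 1 - exp (- exp (- y))"
    by (simp add: measure_def)
  moreover have "{k \<in> space M. X k < y} = space M - (X -` {y..} \<inter> space M)" by auto
  ultimately show ?thesis by (simp add: prob_compl)
qed

text \<open>The product of the Gumbel density with the shifted distribution functions is again a
  multiple of a shifted Gumbel density, whose total mass is one.\<close>

lemma (in prob_space) gumbel_max_prob:
  fixes g :: "nat \<Rightarrow> 'a \<Rightarrow> real" and w :: "nat \<Rightarrow> real"
  assumes iid: "iid_gumbel M N g"
    and i: "i \<in> {1..N}" and J: "J \<subseteq> {1..N}" "i \<notin> J"
    and wi: "w i > 0" and wJ: "\<And>j. j \<in> J \<Longrightarrow> w j > 0"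
  shows "prob {k \<in> space M. \<forall>j\<in>J. g j k + ln (w j) < g i k + ln (w i)} = w i / (w i + sum w J)"
proof -
  have indep: "indep_vars (\<lambda>_. borel) g {1..N}"
    and dens: "\<And>m. m \<in> {1..N} \<Longrightarrow> distributed M lborel (g m) (\<lambda>x. ennreal (gumbel_density x))"
    using iid by (auto simp: iid_gumbel_def)
  have gm: "g m \<in> borel_measurable M" if "m \<in> {1..N}" for m
    using distributed_measurable[OF dens[OF that]] by simp
  note [measurable] = gm[OF i]
  have finJ: "finite J" using J finite_subset by blast
  \<comment> \<open>Index \<open>i\<close> beats \<open>j\<close> exactly when
    \<open>g j k < g i k + c j\<close>.\<close>
  define c where "c j = ln (w i) - ln (w j)" for j
  define W where "W = sum w J"
  have W: "W \<ge> 0" unfolding W_def by (intro sum_nonneg less_imp_le wJ)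
  define q where "q = w i / (w i + W)"
  have q: "q > 0" using wi W by (simp add: q_def)
  \<comment> \<open>Splitting the variables into the blocks \<open>{i}\<close> and \<open>J\<close>
    gives a product law, so the competitors can be integrated out with \<open>g i\<close> held
    fixed.\<close>
  define Y where "Y k = restrict (\<lambda>j. g j k) J" for k
  define X where "X k = restrict (\<lambda>j. g j k) {i}" for k
  have "indep_var (PiM {i} (\<lambda>_. borel)) X (PiM J (\<lambda>_. borel)) Y"
    unfolding X_def Y_def by (rule indep_var_restrict[OF indep]) (use i J in auto)
  then have X[measurable]: "X \<in> measurable M (PiM {i} (\<lambda>_. borel))"
    and Y[measurable]: "Y \<in> measurable M (PiM J (\<lambda>_. borel))"
    and joint: "distr M (PiM {i} (\<lambda>_. borel)) X \<Otimes>\<^sub>M distr M (PiM J (\<lambda>_. borel)) Y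
      = distr M (PiM {i} (\<lambda>_. borel) \<Otimes>\<^sub>M PiM J (\<lambda>_. borel)) (\<lambda>k. (X k, Y k))"
    by (auto simp: indep_var_distribution_eq)
  interpret DY: prob_space "distr M (PiM J (\<lambda>_. borel)) Y" by (rule prob_space_distr[OF Y])
  define A where "A = {z \<in> space (PiM {i} (\<lambda>_. borel) \<Otimes>\<^sub>M PiM J (\<lambda>_. borel :: real measure)).
    \<forall>j\<in>J. snd z j < fst z i + c j}"
  have A[measurable]: "A \<in> sets (PiM {i} (\<lambda>_. borel) \<Otimes>\<^sub>M PiM J (\<lambda>_. borel))"
    unfolding A_def
  proof (rule sets.sets_Collect_finite_All[OF _ finJ])
    fix j assume [measurable]: "j \<in> J"
    show "{z \<in> space (PiM {i} (\<lambda>_. borel) \<Otimes>\<^sub>M PiM J (\<lambda>_. borel :: real measure)). snd z j < fst z i + c j}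
        \<in> sets (PiM {i} (\<lambda>_. borel) \<Otimes>\<^sub>M PiM J (\<lambda>_. borel))" by measurable
  qed
  have inner: "emeasure (distr M (PiM J (\<lambda>_. borel)) Y) (Pair u -` A)
      = ennreal (exp (- exp (- u i) * (W / w i)))"
    if u: "u \<in> space (PiM {i} (\<lambda>_. borel))" for u
  proof -
    define x where "x = u i"
    have "emeasure (distr M (PiM J (\<lambda>_. borel)) Y) (Pair u -` A)
        = emeasure M (Y -` (Pair u -` A) \<inter> space M)"
      by (rule emeasure_distr) (auto intro: sets_Pair1[OF A])
    also have "Y -` (Pair u -` A) \<inter> space M = {k \<in> space M. \<forall>j\<in>J. g j k < x + c j}"
      using u by (auto simp: A_def Y_def space_pair_measure space_PiM x_def)
    also have "emeasure M \<dots> = ennreal (exp (- exp (- x) * (W / w i)))"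
    \<comment> \<open>With no competitors the event is the whole space and \<open>W = 0\<close>.
      This happens when all mass of the token distribution sits on one token.\<close>
    proof (cases "J = {}")
      case True
      then show ?thesis by (simp add: W_def emeasure_space_1)
    next
      case False
      have "{k \<in> space M. \<forall>j\<in>J. g j k < x + c j} = (\<Inter>j\<in>J. g j -` {..<x + c j} \<inter> space M)"
        using False by auto
      then have "prob {k \<in> space M. \<forall>j\<in>J. g j k < x + c j}
          = prob (\<Inter>j\<in>J. g j -` {..<x + c j} \<inter> space M)" by simp
      also have "\<dots> = (\<Prod>j\<in>J. prob (g j -` {..<x + c j} \<inter> space M))"
        by (rule indep_varsD[OF indep]) (use False finJ J in auto)
      also have "\<dots> = (\<Prod>j\<in>J. exp (- (exp (- x) * (w j / w i))))"
      proof (rule prod.cong[OF refl])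
        fix j assume j: "j \<in> J"
        have "g j -` {..<x + c j} \<inter> space M = {k \<in> space M. g j k < x + c j}" by auto
        moreover have "exp (- (x + c j)) = exp (- x) * (w j / w i)"
          using wi wJ[OF j] by (simp add: c_def exp_add exp_diff exp_minus field_simps)
        ultimately show "prob (g j -` {..<x + c j} \<inter> space M) = exp (- (exp (- x) * (w j / w i)))"
          using gumbel_cdf[OF dens, of j "x + c j"] j J by auto
      qed
      also have "\<dots> = exp (- exp (- x) * (W / w i))"
        by (simp add: exp_sum[OF finJ, symmetric] W_def sum_negf sum_distrib_left sum_divide_distrib)
      finally show ?thesis by (simp add: emeasure_eq_measure)
    qed
    finally show ?thesis unfolding x_def .
  qed
  \<comment> \<open>The exponents combine to \<open>exp (- x) * (1 + W / w i)\<close>, and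
    \<open>1 + W / w i\<close> is \<open>1 / q\<close>; hence the shift by \<open>ln q\<close>. The
    factor in \<open>1 * x\<close> is the slope of the affine substitution that removes the
    shift.\<close>
  have density_shift: "gumbel_density x * exp (- exp (- x) * (W / w i)) = q * gumbel_density (ln q + 1 * x)" for x
  proof -
    have "exp (- (ln q + x)) = exp (- x) * (1 + W / w i)"
      using q wi W by (simp add: exp_add exp_diff exp_minus q_def field_simps)
    then have "gumbel_density (ln q + x) = exp (- (ln q + x)) * exp (- (exp (- x) * (1 + W / w i)))"
      by (simp only: gumbel_density_def minus_add_distrib exp_add)
    moreover have "q * exp (- (ln q + x)) = exp (- x)"
      using q by (simp add: exp_add exp_diff exp_minus field_simps)
    ultimately have "q * gumbel_density (ln q + x) = exp (- x) * exp (- (exp (- x) * (1 + W / w i)))"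
      by (metis mult.assoc)
    also have "\<dots> = gumbel_density x * exp (- exp (- x) * (W / w i))"
      by (simp add: gumbel_density_def exp_add[symmetric] algebra_simps)
    finally show ?thesis by simp
  qed
  \<comment> \<open>The total mass is read off from \<open>g i\<close> having this density on a
    probability space.\<close>
  have mass: "(\<integral>\<^sup>+x. ennreal (gumbel_density x) \<partial>lborel) = 1"
    using distributed_emeasure[OF dens[OF i], of UNIV] by (simp add: emeasure_space_1)
  have "{k \<in> space M. \<forall>j\<in>J. g j k + ln (w j) < g i k + ln (w i)} = (\<lambda>k. (X k, Y k)) -` A \<inter> space M"
    by (auto simp: A_def X_def Y_def space_pair_measure space_PiM c_def algebra_simps)
  then have "emeasure M {k \<in> space M. \<forall>j\<in>J. g j k + ln (w j) < g i k + ln (w i)}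
      = emeasure (distr M (PiM {i} (\<lambda>_. borel)) X \<Otimes>\<^sub>M distr M (PiM J (\<lambda>_. borel)) Y) A"
    by (simp add: joint emeasure_distr)
  also have "\<dots> = (\<integral>\<^sup>+u. ennreal (exp (- exp (- u i) * (W / w i))) \<partial>distr M (PiM {i} (\<lambda>_. borel)) X)"
    by (subst DY.emeasure_pair_measure_alt) (auto intro!: nn_integral_cong simp: inner[simplified])
  also have "\<dots> = (\<integral>\<^sup>+k. ennreal (exp (- exp (- g i k) * (W / w i))) \<partial>M)"
    by (subst nn_integral_distr) (simp_all add: X_def)
  also have "\<dots> = (\<integral>\<^sup>+x. ennreal (gumbel_density x) * ennreal (exp (- exp (- x) * (W / w i))) \<partial>lborel)"
    by (rule distributed_nn_integral[OF dens[OF i], symmetric]) measurable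
  also have "\<dots> = (\<integral>\<^sup>+x. ennreal q * ennreal (gumbel_density (ln q + 1 * x)) \<partial>lborel)"
    using q by (simp only: ennreal_mult[symmetric] density_shift gumbel_density_nonneg exp_ge_zero less_imp_le)
  also have "\<dots> = ennreal q * (\<integral>\<^sup>+x. ennreal (gumbel_density (ln q + 1 * x)) \<partial>lborel)"
    by (rule nn_integral_cmult) measurable
  also have "(\<integral>\<^sup>+x. ennreal (gumbel_density (ln q + 1 * x)) \<partial>lborel) = 1"
    using nn_integral_real_affine[of "\<lambda>x. ennreal (gumbel_density x)" 1 "ln q"] mass by simp
  finally show ?thesis using q by (simp add: measure_def q_def W_def)
qed

lemma (in prob_space) expected_tv_gumbel_rule:
  fixes P :: "'v::finite pmf"
  assumes tok: "bij_betw tok {1..N} UNIV" and iid: "iid_gumbel M N g"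
  shows "expected_tv M P (gumbel_rule N tok g) = 1 - (\<Sum>t\<in>UNIV. (pmf P t)\<^sup>2)"
proof -
  define s where "s k m = ereal (g m k) + log_prob (pmf P (tok m))" for k m
  define Z where "Z k = (SOME m. m \<in> {1..N} \<and> \<not> (\<exists>y\<in>{1..N}. s k m < s k y))" for k
  have Z_eq: "arg_max (\<lambda>m. ereal (g m k) + log_prob (pmf P (tok m))) (\<lambda>m. m \<in> {1..N}) = Z k" for k
    unfolding arg_max_def is_arg_max_def Z_def s_def Bex_def ..
  have gm: "g m \<in> borel_measurable M" if "m \<in> {1..N}" for m
    using iid that distributed_measurable[of M lborel "g m" "\<lambda>x. ennreal (gumbel_density x)"]
    by (simp add: iid_gumbel_def)
  have sm: "(\<lambda>k. s k m) \<in> borel_measurable M" if "m \<in> {1..N}" for m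
    using gm[OF that] unfolding s_def by measurable
  have Z_meas: "Z \<in> measurable M (count_space UNIV)"
    unfolding Z_def
    by (rule measurable_some_finite)
       (intro sets.sets_Collect_neg sets.sets_Collect_finite_Ex borel_measurable_less sm | simp)+
  show ?thesis
  proof (rule expected_tv_point_mass)
    show "gumbel_rule N tok g P k = return_pmf (tok (Z k))" for k
      unfolding gumbel_rule_def Z_eq ..
    show tZ[measurable]: "(\<lambda>k. tok (Z k)) \<in> measurable M (count_space UNIV)"
      by (rule measurable_compose[OF Z_meas]) simp
    fix v
    obtain i where i: "i \<in> {1..N}" and v: "v = tok i"
      using tok by (metis UNIV_I bij_betw_imp_surj_on imageE)
    show "pmf P v \<le> prob {k \<in> space M. tok (Z k) = v}"
    proof (cases "pmf P v = 0")
      case False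
      \<comment> \<open>Only tokens of positive probability are real competitors: the others score
        minus infinity and lose to the finite score of \<open>i\<close>.\<close>
      define J where "J = {j \<in> {1..N}. j \<noteq> i \<and> pmf P (tok j) \<noteq> 0}"
      have pos: "pmf P (tok j) > 0" if "pmf P (tok j) \<noteq> 0" for j
        using that pmf_nonneg[of P "tok j"] by linarith
      have "pmf P (tok i) + (\<Sum>j\<in>J. pmf P (tok j)) = (\<Sum>j\<in>insert i J. pmf P (tok j))"
        by (subst sum.insert) (auto simp: J_def)
      also have "\<dots> = (\<Sum>j\<in>{1..N}. pmf P (tok j))"
        using i by (intro sum.mono_neutral_left) (auto simp: J_def)
      also have "\<dots> = 1"
        by (subst sum.reindex_bij_betw[OF tok]) (simp add: sum_pmf_eq_1)
      \<comment> \<open>This makes the denominator of the winning probability equal to 1.\<close>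
      finally have total: "pmf P (tok i) + (\<Sum>j\<in>J. pmf P (tok j)) = 1" .
      have "pmf P v = prob {k \<in> space M. \<forall>j\<in>J. g j k + ln (pmf P (tok j)) < g i k + ln (pmf P (tok i))}"
        by (subst gumbel_max_prob[OF iid i]) (use False v pos total in \<open>auto simp: J_def\<close>)
      also have "\<dots> \<le> prob {k \<in> space M. tok (Z k) = v}"
      proof (rule finite_measure_mono)
        show "{k \<in> space M. \<forall>j\<in>J. g j k + ln (pmf P (tok j)) < g i k + ln (pmf P (tok i))}
            \<subseteq> {k \<in> space M. tok (Z k) = v}"
        proof safe
          fix k assume win: "\<forall>j\<in>J. g j k + ln (pmf P (tok j)) < g i k + ln (pmf P (tok i))"
          \<comment> \<open>A strict win over every other index leaves Hilbert choice no alternative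
            to \<open>i\<close>.\<close>
          have less: "s k j < s k i" if "j \<in> {1..N}" "j \<noteq> i" for j
            using win that False v by (auto simp: s_def log_prob_def J_def)
          then have "\<not> (\<exists>y\<in>{1..N}. s k i < s k y)"
            by (metis less_asym less_irrefl)
          then have "Z k = i"
            unfolding Z_def using less i by (intro some_equality) blast+
          then show "tok (Z k) = v" by (simp add: v)
        qed
      qed measurable
      finally show ?thesis .
    qed simp
  qed
qed

subsection \<open>Inverse sampling\<close>

lemma (in prob_space) expected_tv_inverse_sampling_rule:
  fixes P :: "'v::finite pmf"
  assumes tok: "bij_betw tok {1..N} UNIV" and unif: "uniform_unit M r"
  shows "expected_tv M P (inverse_sampling_rule N tok r) = 1 - (\<Sum>t\<in>UNIV. (pmf P t)\<^sup>2)"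
proof -
  define a where "a m = (\<Sum>j = 1..m. pmf P (tok j))" for m
  have [measurable]: "r \<in> borel_measurable M" and distr_r: "distr M borel r = uniform_measure lborel {0..1}"
    using unif by (auto simp: uniform_unit_def)
  have a_mono: "a m \<le> a n" if "m \<le> n" for m n
    unfolding a_def using that by (intro sum_mono2) auto
  have a_0: "a 0 = 0" by (simp add: a_def)
  have a_N: "a N = 1"
    unfolding a_def by (subst sum.reindex_bij_betw[OF tok]) (simp add: sum_pmf_eq_1)
  define Z where "Z k = (SOME m. m \<in> {1..N} \<and> r k \<in> {a (m - 1)..a m})" for k
  have Z_meas: "Z \<in> measurable M (count_space UNIV)"
    unfolding Z_def by (rule measurable_some_finite) auto
  show ?thesis
  proof (rule expected_tv_point_mass)
    show "inverse_sampling_rule N tok r P k = return_pmf (tok (Z k))" for k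
      unfolding inverse_sampling_rule_def Z_def a_def ..
    show tZ[measurable]: "(\<lambda>k. tok (Z k)) \<in> measurable M (count_space UNIV)"
      by (rule measurable_compose[OF Z_meas]) simp
    fix v
    obtain i where i: "i \<in> {1..N}" and v: "v = tok i"
      using tok by (metis UNIV_I bij_betw_imp_surj_on imageE)
    have step: "a i = a (i - 1) + pmf P v"
      using i v by (cases i) (auto simp: a_def)
    have bounds: "0 \<le> a (i - 1)" "a i \<le> 1"
      using a_mono[of 0 "i - 1"] a_mono[of i N] i a_0 a_N by auto
    \<comment> \<open>The open interval has the same length as the closed one but avoids the
      endpoints shared with its neighbours, where the choice of index may be ambiguous.\<close>
    have "pmf P v = measure (distr M borel r) {a (i - 1)<..<a i}"
    proof -
      have "{0..1} \<inter> {a (i - 1)<..<a i} = {a (i - 1)<..<a i}" using bounds by auto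
      then show ?thesis using step unfolding distr_r by (subst measure_uniform_measure) auto
    qed
    also have "\<dots> = prob {k \<in> space M. a (i - 1) < r k \<and> r k < a i}"
      by (subst measure_distr) (auto intro!: arg_cong[where f = prob])
    also have "\<dots> \<le> prob {k \<in> space M. tok (Z k) = v}"
    proof (rule finite_measure_mono)
      show "{k \<in> space M. a (i - 1) < r k \<and> r k < a i} \<subseteq> {k \<in> space M. tok (Z k) = v}"
      proof safe
        fix k assume k: "a (i - 1) < r k" "r k < a i"
        have "Z k = i"
          unfolding Z_def
        proof (rule some_equality)
          show "i \<in> {1..N} \<and> r k \<in> {a (i - 1)..a i}" using i k by auto
          fix m assume m: "m \<in> {1..N} \<and> r k \<in> {a (m - 1)..a m}"
          have "\<not> m < i" using a_mono[of m "i - 1"] m k by fastforce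
          moreover have "\<not> i < m" using a_mono[of i "m - 1"] m k by fastforce
          ultimately show "m = i" by simp
        qed
        then show "tok (Z k) = v" by (simp add: v)
      qed
    qed measurable
    finally show "pmf P v \<le> prob {k \<in> space M. tok (Z k) = v}" .
  qed
qed

subsection \<open>Permute-reweight\<close>

text \<open>The bijection itself serves as the key, hence \<open>id\<close>; the expectation over
  keys thereby becomes a finite average over bijections.\<close>

definition overlap :: "'v::finite pmf \<Rightarrow> ('v \<Rightarrow> nat) \<Rightarrow> real" where
  "overlap P f = (\<Sum>t\<in>UNIV. min (pmf P t) (permute_reweight_fun id P f t))"

lemma bij_betw_reverse:
  fixes N :: nat
  assumes "bij_betw f A {1..N}"
  shows "bij_betw (\<lambda>t. N + 1 - f t) A {1..N}"
proof -
  have "bij_betw (\<lambda>m. N + 1 - m) {1..N} {1..N}"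
    by (rule bij_betwI[where g = "\<lambda>m. N + 1 - m"]) auto
  from bij_betw_trans[OF assms this] show ?thesis by (simp add: comp_def)
qed

text \<open>Reversing an order swaps predecessors and successors, so this yields the mass before
  \<open>t\<close> in the reversed order.\<close>

lemma sum_pmf_trichotomy:
  fixes P :: "'v::finite pmf" and f :: "'v \<Rightarrow> 'b::linorder"
  assumes "inj f"
  shows "(\<Sum>s | f s < f t. pmf P s) + pmf P t + (\<Sum>s | f t < f s. pmf P s) = (1 :: real)"
proof -
  have "(\<Sum>s\<in>UNIV. pmf P s) = (\<Sum>s\<in>{s. f s < f t} \<union> {t} \<union> {s. f t < f s}. pmf P s)"
  proof (rule sum.cong)
    show "UNIV = {s. f s < f t} \<union> {t} \<union> {s. f t < f s}"
      using assms by (auto simp: inj_def) (metis neq_iff)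
  qed simp
  also have "\<dots> = (\<Sum>s | f s < f t. pmf P s) + pmf P t + (\<Sum>s | f t < f s. pmf P s)"
    by (subst sum.union_disjoint; (subst sum.union_disjoint)?) auto
  finally show ?thesis by (simp add: sum_pmf_eq_1)
qed

lemma permute_reweight_fun_alt:
  fixes P :: "'v::finite pmf"
  assumes f: "bij_betw f UNIV {1..N}"
  shows "permute_reweight_fun id P f t =
    max (2 * ((\<Sum>s | f s < f t. pmf P s) + pmf P t) - 1) 0 - max (2 * (\<Sum>s | f s < f t. pmf P s) - 1) 0"
proof -
  \<comment> \<open>Ranks start at 1, so the subtraction on naturals does not truncate and
    \<open>\<le> f t - 1\<close> means \<open>< f t\<close>.\<close>
  have "f t \<ge> 1" using f by (auto simp: bij_betw_def)
  then have less: "{s. id f s \<le> id f t - 1} = {s. f s < f t}" by auto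
  have "{s. id f s \<le> id f t} = insert t {s. f s < f t}"
    using f by (auto simp: bij_betw_def inj_def order_le_less)
  then have "(\<Sum>s | id f s \<le> id f t. pmf P s) = (\<Sum>s | f s < f t. pmf P s) + pmf P t"
    by simp
  then show ?thesis unfolding permute_reweight_fun_def less by simp
qed

text \<open>Only the token whose cumulative interval contains \<open>1/2\<close> in its interior contributes to
  the sum below: for all others, one of the two orders assigns weight \<open>2 * pmf P t\<close> and the
  reversed one weight zero.\<close>

lemma overlap_reverse:
  fixes P :: "'v::finite pmf"
  assumes f: "bij_betw f UNIV {1..N}"
  defines "S \<equiv> \<lambda>t. \<Sum>s | f s < f t. pmf P s"
  shows "overlap P f + overlap P (\<lambda>t. N + 1 - f t)
    = 1 + (\<Sum>t\<in>UNIV. max 0 (min (2 * (S t + pmf P t) - 1) (1 - 2 * S t)))"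
proof -
  let ?f' = "\<lambda>t. N + 1 - f t"
  have inj: "inj f" using f by (simp add: bij_betw_def)
  have S_eq: "(\<Sum>s | f s < f t. pmf P s) = S t" for t by (simp add: S_def)
  have le: "f t \<le> N" for t using f by (auto simp: bij_betw_def)
  have f': "bij_betw ?f' UNIV {1..N}"
    by (rule bij_betw_reverse[OF f])
  have "min (pmf P t) (permute_reweight_fun id P f t) + min (pmf P t) (permute_reweight_fun id P ?f' t)
      = pmf P t + max 0 (min (2 * (S t + pmf P t) - 1) (1 - 2 * S t))" for t
  proof -
    have "?f' s < ?f' t \<longleftrightarrow> f t < f s" for s using le[of s] le[of t] by linarith
    then have "{s. ?f' s < ?f' t} = {s. f t < f s}" by simp
    then have "(\<Sum>s | ?f' s < ?f' t. pmf P s) = 1 - S t - pmf P t"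
      using sum_pmf_trichotomy[OF inj, where P = P and t = t] by (simp add: S_def)
    moreover have "min p (max (2 * (x + p) - 1) 0 - max (2 * x - 1) 0)
        + min p (max (2 * (1 - x - p + p) - 1) 0 - max (2 * (1 - x - p) - 1) 0)
        = p + max 0 (min (2 * (x + p) - 1) (1 - 2 * x))" if "0 \<le> p" for x p :: real
    proof -
      \<comment> \<open>The interval from \<open>x\<close> to \<open>x + p\<close> ends by 1/2,
        starts at or after it, or straddles it. When it straddles, the two weights add up to
        \<open>2 * p\<close>, so one is capped at \<open>p\<close> and the smaller one
        survives.\<close>
      consider "x + p \<le> 1/2" | "x \<ge> 1/2" | "x < 1/2" "1/2 < x + p" by linarith
      then show ?thesis by cases (use that in \<open>auto simp: max_def min_def\<close>)
    qed
    ultimately show ?thesis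
      unfolding permute_reweight_fun_alt[OF f] permute_reweight_fun_alt[OF f'] S_eq
      by simp
  qed
  then show ?thesis
    unfolding overlap_def by (simp add: sum.distrib[symmetric]) (simp add: sum.distrib sum_pmf_eq_1)
qed

lemma overlap_reverse_bounds:
  fixes P :: "'v::finite pmf"
  assumes f: "bij_betw f UNIV {1..N}"
  shows "max 1 (2 * Max (range (pmf P))) \<le> overlap P f + overlap P (\<lambda>t. N + 1 - f t)" (is ?lower)
    and "overlap P f + overlap P (\<lambda>t. N + 1 - f t) \<le> 1 + Max (range (pmf P))" (is ?upper)
proof -
  define S where "S t = (\<Sum>s | f s < f t. pmf P s)" for t
  define d where "d t = max 0 (min (2 * (S t + pmf P t) - 1) (1 - 2 * S t))" for t
  have inj: "inj f" using f by (simp add: bij_betw_def)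
  have eq: "overlap P f + overlap P (\<lambda>t. N + 1 - f t) = 1 + (\<Sum>t\<in>UNIV. d t)"
    unfolding overlap_reverse[OF f] d_def S_def ..
  have d_nonneg: "0 \<le> d t" for t by (simp add: d_def)
  have S: "0 \<le> S t" "S t + pmf P t \<le> 1" for t
  proof -
    show "0 \<le> S t" by (simp add: S_def sum_nonneg)
    have "0 \<le> (\<Sum>s | f t < f s. pmf P s)" by (simp add: sum_nonneg)
    then show "S t + pmf P t \<le> 1"
      using sum_pmf_trichotomy[OF inj, where P = P and t = t] unfolding S_def by linarith
  qed
  \<comment> \<open>Cumulative intervals follow each other in the order of \<open>f\<close>, so 1/2
    is interior to at most one of them.\<close>
  have S_step: "S s + pmf P s \<le> S t" if "f s < f t" for s t
  proof -
    have "S s + pmf P s = (\<Sum>u\<in>insert s {u. f u < f s}. pmf P u)" by (simp add: S_def)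
    also have "\<dots> \<le> S t" unfolding S_def using that by (intro sum_mono2) auto
    finally show ?thesis .
  qed
  have "Max (range (pmf P)) \<in> range (pmf P)" by (rule Max_in) auto
  then obtain t where t: "pmf P t = Max (range (pmf P))" by (metis imageE)
  \<comment> \<open>Here \<open>S t \<ge> 0\<close> bounds the first argument of \<open>min\<close>
    from below, and \<open>S t + pmf P t \<le> 1\<close> the second.\<close>
  have "2 * pmf P t - 1 \<le> d t" using S[of t] by (auto simp: d_def)
  also have "d t \<le> (\<Sum>t\<in>UNIV. d t)" by (rule member_le_sum) (auto simp: d_nonneg)
  finally show ?lower
    unfolding eq t[symmetric] using d_nonneg by (intro max.boundedI) (simp_all add: sum_nonneg)
  have "(\<Sum>t\<in>UNIV. d t) \<le> Max (range (pmf P))"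
  proof (cases "\<exists>s. d s > 0")
    case True
    then obtain s where s: "d s > 0" by blast
    have "d u = 0" if "u \<noteq> s" for u
    proof -
      have "f u < f s \<or> f s < f u" using inj that by (metis injD linorder_neqE_nat)
      then show ?thesis using s S_step[of u s] S_step[of s u] by (auto simp: d_def)
    qed
    then have "(\<Sum>t\<in>UNIV. d t) = (\<Sum>t\<in>{s}. d t)" by (intro sum.mono_neutral_right) auto
    \<comment> \<open>The two arguments of \<open>min\<close> add up to \<open>2 * pmf P s\<close>,
      so the smaller is at most \<open>pmf P s\<close>.\<close>
    also have "\<dots> \<le> pmf P s" by (auto simp: d_def)
    also have "\<dots> \<le> Max (range (pmf P))" by simp
    finally show ?thesis .
  next
    case False
    then have "(\<Sum>t\<in>UNIV. d t) \<le> 0" by (intro sum_nonpos) (auto simp: not_less)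
    also have "0 \<le> Max (range (pmf P))" using t pmf_nonneg[of P t] by simp
    finally show ?thesis .
  qed
  then show ?upper unfolding eq by simp
qed

lemma (in prob_space) expected_tv_permute_reweight_rule_bounds:
  fixes P :: "'v::finite pmf" and tok :: "nat \<Rightarrow> 'v"
  assumes tok: "bij_betw tok {1..N} UNIV" and unif: "uniform_bijection M N \<pi>"
  shows "max 0.5 (Max (range (pmf P))) \<le> 1 - expected_tv M P (permute_reweight_rule \<pi>)"
    and "1 - expected_tv M P (permute_reweight_rule \<pi>) \<le> (1 + Max (range (pmf P))) / 2"
proof -
  define B where "B = {f :: 'v \<Rightarrow> nat. bij_betw f UNIV {1..N}}"
  have [measurable]: "\<pi> \<in> measurable M (count_space B)"
    and distr_\<pi>: "distr M (count_space B) \<pi> = uniform_count_measure B"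
    using unif by (auto simp: uniform_bijection_def B_def Let_def)
  have "B \<subseteq> {f. \<forall>t. f t \<in> {1..N}}" by (auto simp: B_def bij_betw_def)
  moreover have "finite {f :: 'v \<Rightarrow> nat. \<forall>t. f t \<in> {1..N}}"
    using finite_PiE[of "UNIV :: 'v set" "\<lambda>_. {1..N}"] by (simp add: PiE_def Pi_def)
  ultimately have finB: "finite B" by (rule finite_subset)
  \<comment> \<open>The inverse of the enumeration witnesses that \<open>B\<close> is nonempty, so
    that dividing by \<open>card B\<close> is meaningful.\<close>
  have "the_inv_into {1..N} tok \<in> B"
    using bij_betw_the_inv_into[OF tok] by (simp add: B_def)
  then have cardB: "card B > 0" using finB card_gt_0_iff by blast
  have "1 - expected_tv M P (permute_reweight_rule \<pi>)
      = (LINT k|M. (\<Sum>t\<in>UNIV. min (pmf P t) (pmf (permute_reweight_rule \<pi> P k) t)))"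
    by (simp add: expected_tv_def)
  also have "\<dots> = (LINT k|M. overlap P (\<pi> k))"
  proof (rule Bochner_Integration.integral_cong[OF refl])
    fix k assume "k \<in> space M"
    then have "\<pi> k \<in> B" using measurable_space[of \<pi> M "count_space B"] by simp
    then have "bij_betw (\<pi> k) UNIV {1..N}" by (simp add: B_def)
    then show "(\<Sum>t\<in>UNIV. min (pmf P t) (pmf (permute_reweight_rule \<pi> P k) t)) = overlap P (\<pi> k)"
      by (simp add: overlap_def pmf_permute_reweight_rule permute_reweight_fun_def)
  qed
  also have "\<dots> = (\<integral>f. overlap P f \<partial>distr M (count_space B) \<pi>)"
    by (rule integral_distr[symmetric]) auto
  also have "\<dots> = (\<Sum>f\<in>B. overlap P f) / card B"
    unfolding distr_\<pi> by (rule integral_uniform_count_measure[OF finB])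
  finally have mean: "(1 - expected_tv M P (permute_reweight_rule \<pi>)) * card B = (\<Sum>f\<in>B. overlap P f)"
    using cardB by (simp add: field_simps)
  \<comment> \<open>Reversal is an involution on \<open>B\<close>, because ranks do not exceed
    \<open>N\<close>. Hence the sum of overlaps over \<open>B\<close> equals that over reversed
    bijections, and bounds for each pair pass to the mean.\<close>
  have rev: "bij_betw (\<lambda>f t. N + 1 - f t) B B"
  proof (rule bij_betwI[where g = "\<lambda>f t. N + 1 - f t"])
    show "(\<lambda>f t. N + 1 - f t) \<in> B \<rightarrow> B" "(\<lambda>f t. N + 1 - f t) \<in> B \<rightarrow> B"
      using bij_betw_reverse by (auto simp: B_def simp del: add_Suc_right)
    have "f t \<le> N" if "f \<in> B" for f t
      using that by (auto simp: B_def bij_betw_def)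
    then show "(\<lambda>t. N + 1 - (N + 1 - f t)) = f" "(\<lambda>t. N + 1 - (N + 1 - f t)) = f" if "f \<in> B" for f
      using that by (auto simp: fun_eq_iff le_SucI)
  qed
  have twice: "2 * (\<Sum>f\<in>B. overlap P f) = (\<Sum>f\<in>B. overlap P f + overlap P (\<lambda>t. N + 1 - f t))"
    using sum.reindex_bij_betw[OF rev, of "overlap P"] by (simp add: sum.distrib)
  have "card B * max 1 (2 * Max (range (pmf P))) \<le> 2 * (\<Sum>f\<in>B. overlap P f)"
    unfolding twice by (rule sum_bounded_below) (rule overlap_reverse_bounds(1), simp add: B_def)
  then have "card B * (max 1 (2 * Max (range (pmf P)))) \<le> card B * (2 * (1 - expected_tv M P (permute_reweight_rule \<pi>)))"
    unfolding mean[symmetric] by (simp only: mult.commute mult.left_commute)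
  then have lower: "max 1 (2 * Max (range (pmf P))) \<le> 2 * (1 - expected_tv M P (permute_reweight_rule \<pi>))"
    by (rule mult_left_le_imp_le) (use cardB in simp)
  have "2 * (\<Sum>f\<in>B. overlap P f) \<le> card B * (1 + Max (range (pmf P)))"
    unfolding twice by (rule sum_bounded_above) (rule overlap_reverse_bounds(2), simp add: B_def)
  then have "card B * (2 * (1 - expected_tv M P (permute_reweight_rule \<pi>))) \<le> card B * (1 + Max (range (pmf P)))"
    unfolding mean[symmetric] by (simp only: mult.commute mult.left_commute)
  then have upper: "2 * (1 - expected_tv M P (permute_reweight_rule \<pi>)) \<le> 1 + Max (range (pmf P))"
    by (rule mult_left_le_imp_le) (use cardB in simp)
  from lower show "max 0.5 (Max (range (pmf P))) \<le> 1 - expected_tv M P (permute_reweight_rule \<pi>)"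
    by (intro max.boundedI) (auto dest!: max.boundedE simp del: Max_le_iff)
  from upper show "1 - expected_tv M P (permute_reweight_rule \<pi>) \<le> (1 + Max (range (pmf P))) / 2"
    by (simp del: minus_Max_eq_Min add: field_simps)
qed

theorem theorem4p9:
  fixes P :: "'v::finite pmf"
    and N :: nat and tok :: "nat \<Rightarrow> 'v"
    and M_GR :: "'a measure" and g :: "nat \<Rightarrow> 'a \<Rightarrow> real"
    and M_IS :: "'b measure" and r :: "'b \<Rightarrow> real"
    and M_PR :: "'c measure" and \<pi> :: "'c \<Rightarrow> 'v \<Rightarrow> nat"
  assumes "bij_betw tok {1..N} UNIV"
    and "prob_space M_GR" and "iid_gumbel M_GR N g"
    and "prob_space M_IS" and "uniform_unit M_IS r"
    and "prob_space M_PR" and "uniform_bijection M_PR N \<pi>"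
  shows "expected_tv M_GR P (gumbel_rule N tok g) = expected_tv M_IS P (inverse_sampling_rule N tok r)
    \<and> expected_tv M_IS P (inverse_sampling_rule N tok r) = 1 - (\<Sum>t\<in>UNIV. (pmf P t)\<^sup>2)
    \<and> 0.5 * (1 - Max (range (pmf P))) \<le> expected_tv M_PR P (permute_reweight_rule \<pi>)
    \<and> expected_tv M_PR P (permute_reweight_rule \<pi>) \<le> 0.5 - max (Max (range (pmf P)) - 0.5) 0
    \<and> expected_tv M_PR P (permute_reweight_rule \<pi>) \<le> expected_tv M_IS P (inverse_sampling_rule N tok r)"
proof -
  interpret GR: prob_space M_GR by fact
  interpret IS: prob_space M_IS by fact
  interpret PR: prob_space M_PR by fact
  have "(\<Sum>t\<in>UNIV. (pmf P t)\<^sup>2) \<le> (\<Sum>t\<in>UNIV. Max (range (pmf P)) * pmf P t)"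
    unfolding power2_eq_square by (intro sum_mono mult_right_mono) auto
  also have "\<dots> = Max (range (pmf P))"
    by (simp add: sum_distrib_left[symmetric] sum_pmf_eq_1)
  finally have "(\<Sum>t\<in>UNIV. (pmf P t)\<^sup>2) \<le> Max (range (pmf P))" .
  \<comment> \<open>Write \<open>m\<close> for the maximum of \<open>P\<close>. The stated upper
    bound \<open>0.5 - max (m - 0.5) 0\<close> is \<open>1 - max 0.5 m\<close>; this is at most
    \<open>1 - m\<close>, and so at most one minus the sum of squares.\<close>
  then show ?thesis
    using PR.expected_tv_permute_reweight_rule_bounds[OF assms(1,7), of P]
    unfolding GR.expected_tv_gumbel_rule[OF assms(1,3)]
      IS.expected_tv_inverse_sampling_rule[OF assms(1,5)]
    by (auto simp del: Max_le_iff minus_Max_eq_Min simp: max_def split: if_splits)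
qed

end
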